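(* Let $P$ be an aggregate program (over an aggregate signature $\Sigma$, a $\Sigma$-structure $\mathcal D$ and defined predicates $\Pi$) and let $\tilde{\mathcal D}_1,\tilde{\mathcal D}_2$ be three-valued $\Sigma$-structures approximating $\mathcal D$ with $\tilde{\mathcal D}_1\le_p\tilde{\mathcal D}_2$. Then: the $\tilde{\mathcal D}_1$-Kripke–Kleene model of $P$ is $\le_p$-below the $\tilde{\mathcal D}_2$-Kripke–Kleene model of $P$; the $\tilde{\mathcal D}_1$-well-founded model of $P$ is $\le_p$-below the $\tilde{\mathcal D}_2$-well-founded model of $P$; and every $\tilde{\mathcal D}_1$-stable model of $P$ is a $\tilde{\mathcal D}_2$-stable model of $P$.
   Context: Aggregate relation: $R\subseteq\mathcal P(D_1)\times D_2$. An aggregate signature $\Sigma$ has sorts, sorted function, predicate and aggregate symbols $\mathsf R:\{s_1\times\dots\times s_n\}\times w$; set expressions $\{(x_1,\dots,x_n)\mid\varphi\}$, aggregate atoms $\mathsf R(s,t)$ and aggregate formulas (closed under $\neg,\wedge,\vee,\forall,\exists$) are defined simultaneously; a $\Sigma$-structure interprets aggregate symbols by aggregate relations and set expressions by the set of satisfying tuples. Programs: $\Pi$ is a set of predicate symbols not in $\Sigma$; rules are $A\leftarrow\varphi$ with $A$ a $\Pi$-atom and $\varphi$ a $\Sigma(\Pi)$-aggregate formula; interpretations are subsets of $base_{\mathcal D}(\Pi)$ (ground $\Pi$-atoms over domain elements); $inst_{\mathcal D}(P)$ is the set of ground instances of rules of $P$; $T_{P,\mathcal D}(I)$ is the set of heads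 of ground instances whose body holds in $\mathcal D(I)$ (the extension of $\mathcal D$ making exactly the atoms of $I$ true). Three-valued semantics: $\mathbf{THREE}=\{(\mathbf f,\mathbf f),(\mathbf f,\mathbf t),(\mathbf t,\mathbf t)\}$, truth order componentwise (meet $\wedge$, join $\vee$), $\neg(x,y)=(\neg y,\neg x)$, precision order $(x,y)\le_p(x',y')$ iff $x\le x'$ and $y'\le y$. Three-valued sets are pairs $(S_1,S_2)$, $S_1\subseteq S_2$, ordered by $(S_1,S_2)\le_p(S'_1,S'_2)$ iff $S_1\subseteq S_1'$, $S_2'\subseteq S_2$. A three-valued aggregate relation $\mathcal R:\mathcal P(D_1)^c\times D_2\to\mathbf{THREE}$ is $\le_p$-monotone in its set argument and two-valued on exact sets $(S,S)$; it approximates $R$ if $\mathcal R((S,S),d)$ is true iff $(S,d)\in R$. A three-valued structure $\tilde{\mathcal D}$ approximating $\mathcal D$ agrees with $\mathcal D$ except that each aggregate symbol is interpreted by a three-valued aggregate relation approximating its $\mathcal D$-interpretation; $\tilde{\mathcal D}_1\le_p\tilde{\mathcal D}_2$ means $\mathsf R^{\tilde{\mathcal D}_1}(\tilde S,d)\le_p\mathsf R^{\tilde{\mathcal D}_2}(\tilde S,d)$ for all aggregate symbols $\mathsf R$ and all arguments. Three-valued interpretations are pairs $(I_1,I_2)$ with $I_1\subseteq I_2$ ($A$ has value $(A\in I_1,A\in I_2)$), ordered by $(I_1,I_2)\le_p(J_1,J_2)$ iff $I_1\subseteq J_1$, $J_2\subseteq I_2$. Formula values $\mathcal H_{\tilde{\mathcal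 D}(I_1,I_2)}(\varphi)$ are computed inductively with $\mathbf{THREE}$-connectives, quantifiers as join/meet, set expressions evaluating to $(S_1,S_2)$ with $S_1$ the tuples where the condition is true and $S_2$ those where it is not false, and $\mathsf R(s,t)$ evaluating to $\mathsf R^{\tilde{\mathcal D}}$ of the values. $\Phi_{P,\tilde{\mathcal D}}(I_1,I_2)$ assigns to each ground atom $A$ the join of the values of the bodies of the ground rules with head $A$ (false if none). The $\tilde{\mathcal D}$-Kripke–Kleene model is the $\le_p$-least fixpoint of $\Phi_{P,\tilde{\mathcal D}}$; the $\tilde{\mathcal D}$-well-founded model and $\tilde{\mathcal D}$-stable models are its well-founded and exact stable fixpoints, where for $A$ with components $A^1,A^2$: $A^\downarrow(b)=\mathrm{glb}\{x\subseteq b\mid A^1(x,b)\subseteq x\}$, $A^\uparrow(a)=\mathrm{glb}\{x\supseteq a\mid A^2(a,x)\subseteq x\}$, $\mathcal S_A(a,b)=(A^\downarrow(b),A^\uparrow(a))$; the well-founded fixpoint is the $\le_p$-least fixpoint of $\mathcal S_A$ on pairs $(a,b)$ with $(a,b)\le_p A(a,b)$ and $a\subseteq A^\downarrow(b)$; an exact stable fixpoint is an $I$ with $\mathcal S_A(I,I)=(I,I)$. *)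

theory Defs
  imports Main "HOL-Library.Product_Order"
begin

section \<open>Precision order and approximating operators\<close>

text \<open>The same relation is used for \<open>THREE\<close> (at type bool), for three-valued sets and for
  three-valued interpretations. The truth order on pairs is the componentwise order \<open>\<le>\<close> of
  Product_Order, with its \<open>\<sqinter>\<close>, \<open>\<squnion>\<close>, Inf and Sup.\<close>

definition le_p :: "'a::ord \<times> 'a \<Rightarrow> 'a \<times> 'a \<Rightarrow> bool" (infix "\<le>\<^sub>p" 50) where
  "x \<le>\<^sub>p y \<longleftrightarrow> fst x \<le> fst y \<and> snd y \<le> snd x"

definition THREE :: "(bool \<times> bool) set" where
  "THREE = {(False, False), (False, True), (True, True)}"

definition neg3 :: "bool \<times> bool \<Rightarrow> bool \<times> bool" where
  "neg3 v = (\<not> snd v, \<not> fst v)"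

text \<open>The set \<open>\<P>(B)\<^sup>c\<close> of consistent pairs of subsets of \<open>B\<close>.\<close>

definition consistent :: "'b set \<Rightarrow> ('b set \<times> 'b set) set" where
  "consistent B = {(x, y). x \<subseteq> y \<and> y \<subseteq> B}"

definition least_p_fixpoint :: "('b set \<times> 'b set) set \<Rightarrow> ('b set \<times> 'b set \<Rightarrow> 'b set \<times> 'b set)
    \<Rightarrow> 'b set \<times> 'b set \<Rightarrow> bool" where
  "least_p_fixpoint X F x \<longleftrightarrow> x \<in> X \<and> F x = x \<and> (\<forall>y\<in>X. F y = y \<longrightarrow> x \<le>\<^sub>p y)"

text \<open>Greatest lower bounds are taken in the lattice of subsets of \<open>B\<close>; the intersection with \<open>B\<close>
  makes the glb of the empty family equal to \<open>B\<close>.\<close>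

definition down_op :: "'b set \<Rightarrow> ('b set \<times> 'b set \<Rightarrow> 'b set \<times> 'b set) \<Rightarrow> 'b set \<Rightarrow> 'b set" where
  "down_op B A b = B \<inter> \<Inter>{x. x \<subseteq> b \<and> fst (A (x, b)) \<subseteq> x}"

definition up_op :: "'b set \<Rightarrow> ('b set \<times> 'b set \<Rightarrow> 'b set \<times> 'b set) \<Rightarrow> 'b set \<Rightarrow> 'b set" where
  "up_op B A a = B \<inter> \<Inter>{x. a \<subseteq> x \<and> x \<subseteq> B \<and> snd (A (a, x)) \<subseteq> x}"

definition stable_op ::
  "'b set \<Rightarrow> ('b set \<times> 'b set \<Rightarrow> 'b set \<times> 'b set) \<Rightarrow> 'b set \<times> 'b set \<Rightarrow> 'b set \<times> 'b set" where
  "stable_op B A x = (down_op B A (snd x), up_op B A (fst x))"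

definition prudent :: "'b set \<Rightarrow> ('b set \<times> 'b set \<Rightarrow> 'b set \<times> 'b set) \<Rightarrow> ('b set \<times> 'b set) set" where
  "prudent B A = {x \<in> consistent B. x \<le>\<^sub>p A x \<and> fst x \<subseteq> down_op B A (snd x)}"

definition kk_fixpoint :: "'b set \<Rightarrow> ('b set \<times> 'b set \<Rightarrow> 'b set \<times> 'b set) \<Rightarrow> 'b set \<times> 'b set" where
  "kk_fixpoint B A = (THE x. least_p_fixpoint (consistent B) A x)"

definition wf_fixpoint :: "'b set \<Rightarrow> ('b set \<times> 'b set \<Rightarrow> 'b set \<times> 'b set) \<Rightarrow> 'b set \<times> 'b set" where
  "wf_fixpoint B A = (THE x. least_p_fixpoint (prudent B A) (stable_op B A) x)"

definition exact_stable_fixpoint ::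
  "'b set \<Rightarrow> ('b set \<times> 'b set \<Rightarrow> 'b set \<times> 'b set) \<Rightarrow> 'b set \<Rightarrow> bool" where
  "exact_stable_fixpoint B A I \<longleftrightarrow> I \<subseteq> B \<and> stable_op B A (I, I) = (I, I)"

section \<open>Aggregate signatures and formulas\<close>

text \<open>The symbols of a signature are the domains of the partial maps. \<open>agg_sig \<Sigma> R = Some (ss, w)\<close>
  stands for \<open>R : {s\<^sub>1 \<times> \<dots> \<times> s\<^sub>n} \<times> w\<close> with \<open>ss = [s\<^sub>1, \<dots>, s\<^sub>n]\<close>.\<close>

record ('s, 'f, 'p, 'a) agg_signature =
  sorts :: "'s set"
  func_sig :: "'f \<rightharpoonup> 's list \<times> 's"
  pred_sig :: "'p \<rightharpoonup> 's list"
  agg_sig :: "'a \<rightharpoonup> 's list \<times> 's"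

definition wf_signature :: "('s, 'f, 'p, 'a) agg_signature \<Rightarrow> bool" where
  "wf_signature \<Sigma> \<longleftrightarrow>
     (\<forall>(ss, s) \<in> ran (func_sig \<Sigma>). set ss \<subseteq> sorts \<Sigma> \<and> s \<in> sorts \<Sigma>) \<and>
     (\<forall>ss \<in> ran (pred_sig \<Sigma>). set ss \<subseteq> sorts \<Sigma>) \<and>
     (\<forall>(ss, w) \<in> ran (agg_sig \<Sigma>). set ss \<subseteq> sorts \<Sigma> \<and> w \<in> sorts \<Sigma>)"

definition defined_preds :: "('s, 'f, 'p, 'a) agg_signature \<Rightarrow> ('p \<rightharpoonup> 's list) \<Rightarrow> bool" where
  "defined_preds \<Sigma> \<Pi> \<longleftrightarrow>
     dom \<Pi> \<inter> dom (pred_sig \<Sigma>) = {} \<and> (\<forall>ss \<in> ran \<Pi>. set ss \<subseteq> sorts \<Sigma>)"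

definition extend_sig ::
  "('s, 'f, 'p, 'a) agg_signature \<Rightarrow> ('p \<rightharpoonup> 's list) \<Rightarrow> ('s, 'f, 'p, 'a) agg_signature" where
  "extend_sig \<Sigma> \<Pi> = \<Sigma>\<lparr>pred_sig := pred_sig \<Sigma> ++ \<Pi>\<rparr>"

text \<open>A variable is a name together with its sort.\<close>

datatype ('v, 's, 'f) trm = Var "'v \<times> 's" | Fun 'f "('v, 's, 'f) trm list"

datatype ('v, 's, 'f, 'p, 'a) formula =
    Atom 'p "('v, 's, 'f) trm list"
  | AggAtom 'a "('v, 's, 'f, 'p, 'a) set_expr" "('v, 's, 'f) trm"
  | Neg "('v, 's, 'f, 'p, 'a) formula"
  | Conj "('v, 's, 'f, 'p, 'a) formula" "('v, 's, 'f, 'p, 'a) formula"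
  | Disj "('v, 's, 'f, 'p, 'a) formula" "('v, 's, 'f, 'p, 'a) formula"
  | Forall "'v \<times> 's" "('v, 's, 'f, 'p, 'a) formula"
  | Exists "'v \<times> 's" "('v, 's, 'f, 'p, 'a) formula"
and ('v, 's, 'f, 'p, 'a) set_expr =
    SetExpr "('v \<times> 's) list" "('v, 's, 'f, 'p, 'a) formula"

inductive has_sort :: "('s, 'f, 'p, 'a) agg_signature \<Rightarrow> ('v, 's, 'f) trm \<Rightarrow> 's \<Rightarrow> bool"
  for \<Sigma> where
  "s \<in> sorts \<Sigma> \<Longrightarrow> has_sort \<Sigma> (Var (x, s)) s"
| "func_sig \<Sigma> f = Some (ss, s) \<Longrightarrow> list_all2 (has_sort \<Sigma>) ts ss \<Longrightarrow> has_sort \<Sigma> (Fun f ts) s"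

primrec wf_formula :: "('s, 'f, 'p, 'a) agg_signature \<Rightarrow> ('v, 's, 'f, 'p, 'a) formula \<Rightarrow> bool"
  and wf_set_expr ::
    "('s, 'f, 'p, 'a) agg_signature \<Rightarrow> ('v, 's, 'f, 'p, 'a) set_expr \<Rightarrow> 's list \<Rightarrow> bool" where
  "wf_formula \<Sigma> (Atom p ts) \<longleftrightarrow> (\<exists>ss. pred_sig \<Sigma> p = Some ss \<and> list_all2 (has_sort \<Sigma>) ts ss)"
| "wf_formula \<Sigma> (AggAtom R S t) \<longleftrightarrow>
     (\<exists>ss w. agg_sig \<Sigma> R = Some (ss, w) \<and> wf_set_expr \<Sigma> S ss \<and> has_sort \<Sigma> t w)"
| "wf_formula \<Sigma> (Neg \<phi>) \<longleftrightarrow> wf_formula \<Sigma> \<phi>"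
| "wf_formula \<Sigma> (Conj \<phi> \<psi>) \<longleftrightarrow> wf_formula \<Sigma> \<phi> \<and> wf_formula \<Sigma> \<psi>"
| "wf_formula \<Sigma> (Disj \<phi> \<psi>) \<longleftrightarrow> wf_formula \<Sigma> \<phi> \<and> wf_formula \<Sigma> \<psi>"
| "wf_formula \<Sigma> (Forall x \<phi>) \<longleftrightarrow> snd x \<in> sorts \<Sigma> \<and> wf_formula \<Sigma> \<phi>"
| "wf_formula \<Sigma> (Exists x \<phi>) \<longleftrightarrow> snd x \<in> sorts \<Sigma> \<and> wf_formula \<Sigma> \<phi>"
| "wf_set_expr \<Sigma> (SetExpr xs \<phi>) ss \<longleftrightarrow>
     map snd xs = ss \<and> set ss \<subseteq> sorts \<Sigma> \<and> wf_formula \<Sigma> \<phi>"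

primrec fv_trm :: "('v, 's, 'f) trm \<Rightarrow> ('v \<times> 's) set" where
  "fv_trm (Var x) = {x}"
| "fv_trm (Fun f ts) = \<Union>(set (map fv_trm ts))"

primrec fv :: "('v, 's, 'f, 'p, 'a) formula \<Rightarrow> ('v \<times> 's) set"
  and fv_set_expr :: "('v, 's, 'f, 'p, 'a) set_expr \<Rightarrow> ('v \<times> 's) set" where
  "fv (Atom p ts) = \<Union>(fv_trm ` set ts)"
| "fv (AggAtom R S t) = fv_set_expr S \<union> fv_trm t"
| "fv (Neg \<phi>) = fv \<phi>"
| "fv (Conj \<phi> \<psi>) = fv \<phi> \<union> fv \<psi>"
| "fv (Disj \<phi> \<psi>) = fv \<phi> \<union> fv \<psi>"
| "fv (Forall x \<phi>) = fv \<phi> - {x}"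
| "fv (Exists x \<phi>) = fv \<phi> - {x}"
| "fv_set_expr (SetExpr xs \<phi>) = fv \<phi> - set xs"

section \<open>Two-valued and three-valued structures\<close>

text \<open>The sort domains are subsets of one type \<open>'d\<close>; tuples are lists.\<close>

record ('s, 'f, 'p, 'd) base_structure =
  sdom :: "'s \<Rightarrow> 'd set"
  fint :: "'f \<Rightarrow> 'd list \<Rightarrow> 'd"
  pint :: "'p \<Rightarrow> 'd list set"

record ('s, 'f, 'p, 'a, 'd) agg_structure = "('s, 'f, 'p, 'd) base_structure" +
  aint :: "'a \<Rightarrow> ('d list set \<times> 'd) set"

record ('s, 'f, 'p, 'a, 'd) agg_structure3 = "('s, 'f, 'p, 'd) base_structure" +
  aint3 :: "'a \<Rightarrow> 'd list set \<times> 'd list set \<Rightarrow> 'd \<Rightarrow> bool \<times> bool"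

definition tuples :: "('s, 'f, 'p, 'd, 'z) base_structure_scheme \<Rightarrow> 's list \<Rightarrow> 'd list set" where
  "tuples D ss = {ds. list_all2 (\<lambda>d s. d \<in> sdom D s) ds ss}"

definition is_structure ::
  "('s, 'f, 'p, 'a) agg_signature \<Rightarrow> ('s, 'f, 'p, 'a, 'd) agg_structure \<Rightarrow> bool" where
  "is_structure \<Sigma> D \<longleftrightarrow>
     (\<forall>f ss s. func_sig \<Sigma> f = Some (ss, s) \<longrightarrow> (\<forall>ds \<in> tuples D ss. fint D f ds \<in> sdom D s)) \<and>
     (\<forall>p ss. pred_sig \<Sigma> p = Some ss \<longrightarrow> pint D p \<subseteq> tuples D ss) \<and>
     (\<forall>R ss w. agg_sig \<Sigma> R = Some (ss, w) \<longrightarrow> aint D R \<subseteq> Pow (tuples D ss) \<times> sdom D w)"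

definition agg_relation3 ::
  "'b set \<Rightarrow> 'd set \<Rightarrow> ('b set \<times> 'b set \<Rightarrow> 'd \<Rightarrow> bool \<times> bool) \<Rightarrow> bool" where
  "agg_relation3 D1 D2 Q \<longleftrightarrow>
     (\<forall>S \<in> consistent D1. \<forall>d \<in> D2. Q S d \<in> THREE) \<and>
     (\<forall>S \<in> consistent D1. \<forall>S' \<in> consistent D1. \<forall>d \<in> D2. S \<le>\<^sub>p S' \<longrightarrow> Q S d \<le>\<^sub>p Q S' d) \<and>
     (\<forall>S. S \<subseteq> D1 \<longrightarrow> (\<forall>d \<in> D2. Q (S, S) d \<in> {(False, False), (True, True)}))"

definition approximates_relation :: "'b set \<Rightarrow> 'd set \<Rightarrow>
    ('b set \<times> 'b set \<Rightarrow> 'd \<Rightarrow> bool \<times> bool) \<Rightarrow> ('b set \<times> 'd) set \<Rightarrow> bool" where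
  "approximates_relation D1 D2 Q R \<longleftrightarrow>
     (\<forall>S. S \<subseteq> D1 \<longrightarrow> (\<forall>d \<in> D2. Q (S, S) d = (True, True) \<longleftrightarrow> (S, d) \<in> R))"

definition approximates_structure :: "('s, 'f, 'p, 'a) agg_signature \<Rightarrow>
    ('s, 'f, 'p, 'a, 'd) agg_structure3 \<Rightarrow> ('s, 'f, 'p, 'a, 'd) agg_structure \<Rightarrow> bool" where
  "approximates_structure \<Sigma> D3 D \<longleftrightarrow>
     sdom D3 = sdom D \<and> fint D3 = fint D \<and> pint D3 = pint D \<and>
     (\<forall>R ss w. agg_sig \<Sigma> R = Some (ss, w) \<longrightarrow>
        agg_relation3 (tuples D ss) (sdom D w) (aint3 D3 R) \<and>
        approximates_relation (tuples D ss) (sdom D w) (aint3 D3 R) (aint D R))"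

definition le_structure :: "('s, 'f, 'p, 'a) agg_signature \<Rightarrow>
    ('s, 'f, 'p, 'a, 'd) agg_structure3 \<Rightarrow> ('s, 'f, 'p, 'a, 'd) agg_structure3 \<Rightarrow> bool" where
  "le_structure \<Sigma> D1 D2 \<longleftrightarrow>
     (\<forall>R ss w. agg_sig \<Sigma> R = Some (ss, w) \<longrightarrow>
        (\<forall>S \<in> consistent (tuples D1 ss). \<forall>d \<in> sdom D1 w. aint3 D1 R S d \<le>\<^sub>p aint3 D2 R S d))"

section \<open>Three-valued evaluation\<close>

primrec eval_trm :: "('s, 'f, 'p, 'd, 'z) base_structure_scheme \<Rightarrow> ('v \<times> 's \<Rightarrow> 'd)
    \<Rightarrow> ('v, 's, 'f) trm \<Rightarrow> 'd" where
  "eval_trm D \<theta> (Var x) = \<theta> x"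
| "eval_trm D \<theta> (Fun f ts) = fint D f (map (eval_trm D \<theta>) ts)"

definition sorted_on ::
  "('s, 'f, 'p, 'd, 'z) base_structure_scheme \<Rightarrow> ('v \<times> 's) set \<Rightarrow> ('v \<times> 's \<Rightarrow> 'd) \<Rightarrow> bool" where
  "sorted_on D X \<theta> \<longleftrightarrow> (\<forall>x \<in> X. \<theta> x \<in> sdom D (snd x))"

definition variants :: "('s, 'f, 'p, 'd, 'z) base_structure_scheme \<Rightarrow> ('v \<times> 's) set
    \<Rightarrow> ('v \<times> 's \<Rightarrow> 'd) \<Rightarrow> ('v \<times> 's \<Rightarrow> 'd) set" where
  "variants D X \<theta> = {\<theta>'. (\<forall>x. x \<notin> X \<longrightarrow> \<theta>' x = \<theta> x) \<and> sorted_on D X \<theta>'}"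

text \<open>\<open>eval D \<Pi> I \<phi> \<theta>\<close> is the value of \<open>\<phi>\<close> under the assignment \<open>\<theta>\<close> in \<open>D\<close> extended
  by the three-valued interpretation \<open>I\<close> of the predicates \<open>\<Pi>\<close>.\<close>

primrec eval :: "('s, 'f, 'p, 'a, 'd) agg_structure3 \<Rightarrow> ('p \<rightharpoonup> 's list)
    \<Rightarrow> ('p \<times> 'd list) set \<times> ('p \<times> 'd list) set
    \<Rightarrow> ('v, 's, 'f, 'p, 'a) formula \<Rightarrow> ('v \<times> 's \<Rightarrow> 'd) \<Rightarrow> bool \<times> bool"
  and eval_set :: "('s, 'f, 'p, 'a, 'd) agg_structure3 \<Rightarrow> ('p \<rightharpoonup> 's list)
    \<Rightarrow> ('p \<times> 'd list) set \<times> ('p \<times> 'd list) set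
    \<Rightarrow> ('v, 's, 'f, 'p, 'a) set_expr \<Rightarrow> ('v \<times> 's \<Rightarrow> 'd) \<Rightarrow> 'd list set \<times> 'd list set" where
  "eval D \<Pi> I (Atom p ts) \<theta> =
     (let ds = map (eval_trm D \<theta>) ts in
      if p \<in> dom \<Pi> then ((p, ds) \<in> fst I, (p, ds) \<in> snd I) else (ds \<in> pint D p, ds \<in> pint D p))"
| "eval D \<Pi> I (AggAtom R S t) \<theta> = aint3 D R (eval_set D \<Pi> I S \<theta>) (eval_trm D \<theta> t)"
| "eval D \<Pi> I (Neg \<phi>) \<theta> = neg3 (eval D \<Pi> I \<phi> \<theta>)"
| "eval D \<Pi> I (Conj \<phi> \<psi>) \<theta> = inf (eval D \<Pi> I \<phi> \<theta>) (eval D \<Pi> I \<psi> \<theta>)"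
| "eval D \<Pi> I (Disj \<phi> \<psi>) \<theta> = sup (eval D \<Pi> I \<phi> \<theta>) (eval D \<Pi> I \<psi> \<theta>)"
| "eval D \<Pi> I (Forall x \<phi>) \<theta> = (INF d \<in> sdom D (snd x). eval D \<Pi> I \<phi> (\<theta>(x := d)))"
| "eval D \<Pi> I (Exists x \<phi>) \<theta> = (SUP d \<in> sdom D (snd x). eval D \<Pi> I \<phi> (\<theta>(x := d)))"
| "eval_set D \<Pi> I (SetExpr xs \<phi>) \<theta> =
     ({map \<theta>' xs | \<theta>'. \<theta>' \<in> variants D (set xs) \<theta> \<and> eval D \<Pi> I \<phi> \<theta>' = (True, True)},
      {map \<theta>' xs | \<theta>'. \<theta>' \<in> variants D (set xs) \<theta> \<and> eval D \<Pi> I \<phi> \<theta>' \<noteq> (False, False)})"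

section \<open>Aggregate programs and their models\<close>

text \<open>A rule \<open>p(ts) \<leftarrow> \<phi>\<close> is the triple \<open>(p, ts, \<phi>)\<close>.\<close>

type_synonym ('v, 's, 'f, 'p, 'a) rule =
  "'p \<times> ('v, 's, 'f) trm list \<times> ('v, 's, 'f, 'p, 'a) formula"

definition is_program :: "('s, 'f, 'p, 'a) agg_signature \<Rightarrow> ('p \<rightharpoonup> 's list)
    \<Rightarrow> ('v, 's, 'f, 'p, 'a) rule set \<Rightarrow> bool" where
  "is_program \<Sigma> \<Pi> P \<longleftrightarrow> (\<forall>(p, ts, \<phi>) \<in> P.
     (\<exists>ss. \<Pi> p = Some ss \<and> list_all2 (has_sort \<Sigma>) ts ss) \<and> wf_formula (extend_sig \<Sigma> \<Pi>) \<phi>)"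

definition base :: "('s, 'f, 'p, 'd, 'z) base_structure_scheme \<Rightarrow> ('p \<rightharpoonup> 's list)
    \<Rightarrow> ('p \<times> 'd list) set" where
  "base D \<Pi> = {(p, ds). \<exists>ss. \<Pi> p = Some ss \<and> ds \<in> tuples D ss}"

text \<open>The body of a ground instance is kept as a formula together with the assignment of domain
  elements to the free variables of the rule.\<close>

definition inst :: "('s, 'f, 'p, 'd, 'z) base_structure_scheme \<Rightarrow> ('v, 's, 'f, 'p, 'a) rule set
    \<Rightarrow> (('p \<times> 'd list) \<times> ('v, 's, 'f, 'p, 'a) formula \<times> ('v \<times> 's \<Rightarrow> 'd)) set" where
  "inst D P = {((p, map (eval_trm D \<theta>) ts), \<phi>, \<theta>) | p ts \<phi> \<theta>.
     (p, ts, \<phi>) \<in> P \<and> sorted_on D (\<Union>(fv_trm ` set ts) \<union> fv \<phi>) \<theta>}"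

definition head_value :: "('s, 'f, 'p, 'a, 'd) agg_structure3 \<Rightarrow> ('p \<rightharpoonup> 's list)
    \<Rightarrow> ('v, 's, 'f, 'p, 'a) rule set \<Rightarrow> ('p \<times> 'd list) set \<times> ('p \<times> 'd list) set
    \<Rightarrow> 'p \<times> 'd list \<Rightarrow> bool \<times> bool" where
  "head_value D \<Pi> P I A = Sup {eval D \<Pi> I \<phi> \<theta> | \<phi> \<theta>. (A, \<phi>, \<theta>) \<in> inst D P}"

definition Phi :: "('s, 'f, 'p, 'a, 'd) agg_structure3 \<Rightarrow> ('p \<rightharpoonup> 's list)
    \<Rightarrow> ('v, 's, 'f, 'p, 'a) rule set \<Rightarrow> ('p \<times> 'd list) set \<times> ('p \<times> 'd list) set
    \<Rightarrow> ('p \<times> 'd list) set \<times> ('p \<times> 'd list) set" where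
  "Phi D \<Pi> P I = ({A \<in> base D \<Pi>. fst (head_value D \<Pi> P I A)},
                  {A \<in> base D \<Pi>. snd (head_value D \<Pi> P I A)})"

definition kripke_kleene_model :: "('s, 'f, 'p, 'a, 'd) agg_structure3 \<Rightarrow> ('p \<rightharpoonup> 's list)
    \<Rightarrow> ('v, 's, 'f, 'p, 'a) rule set \<Rightarrow> ('p \<times> 'd list) set \<times> ('p \<times> 'd list) set" where
  "kripke_kleene_model D \<Pi> P = kk_fixpoint (base D \<Pi>) (Phi D \<Pi> P)"

definition well_founded_model :: "('s, 'f, 'p, 'a, 'd) agg_structure3 \<Rightarrow> ('p \<rightharpoonup> 's list)
    \<Rightarrow> ('v, 's, 'f, 'p, 'a) rule set \<Rightarrow> ('p \<times> 'd list) set \<times> ('p \<times> 'd list) set" where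
  "well_founded_model D \<Pi> P = wf_fixpoint (base D \<Pi>) (Phi D \<Pi> P)"

definition stable_model :: "('s, 'f, 'p, 'a, 'd) agg_structure3 \<Rightarrow> ('p \<rightharpoonup> 's list)
    \<Rightarrow> ('v, 's, 'f, 'p, 'a) rule set \<Rightarrow> ('p \<times> 'd list) set \<Rightarrow> bool" where
  "stable_model D \<Pi> P I \<longleftrightarrow> exact_stable_fixpoint (base D \<Pi>) (Phi D \<Pi> P) I"

end

theory Submission
  imports Defs
begin

text \<open>
  The operators of the two programs satisfy \<open>\<Phi>\<^sub>1 x \<le>\<^sub>p \<Phi>\<^sub>2 x\<close> and agree on exact pairs, because
  three-valued evaluation is \<open>\<le>\<^sub>p\<close>-monotone simultaneously in the structure and in the
  interpretation and is exact on exact interpretations. Every prudent pair of \<open>\<Phi>\<^sub>1\<close> is then prudent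
  for \<open>\<Phi>\<^sub>2\<close>, and the stable operator of \<open>\<Phi>\<^sub>1\<close> lies below that of \<open>\<Phi>\<^sub>2\<close>, so the transfinite iterations
  which lead to the least fixpoints for \<open>\<Phi>\<^sub>1\<close> stay below any fixpoint for \<open>\<Phi>\<^sub>2\<close>. Zorn's lemma replaces
  the transfinite iteration: among the postfixpoints which lie below all points that the iteration
  cannot pass, a maximal one is a fixpoint.
\<close>

section \<open>Least fixpoints in the precision order\<close>

lemma le_p_refl [simp]: "(x :: 'b::order \<times> 'b) \<le>\<^sub>p x"
  by (simp add: le_p_def)

lemma le_p_trans: "(x :: 'b::order \<times> 'b) \<le>\<^sub>p y \<Longrightarrow> y \<le>\<^sub>p z \<Longrightarrow> x \<le>\<^sub>p z"
  by (auto simp: le_p_def)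

lemma le_p_antisym: "(x :: 'b::order \<times> 'b) \<le>\<^sub>p y \<Longrightarrow> y \<le>\<^sub>p x \<Longrightarrow> x = y"
  by (auto simp: le_p_def prod_eq_iff)

lemma consistent_iff: "x \<in> consistent B \<longleftrightarrow> fst x \<subseteq> snd x \<and> snd x \<subseteq> B"
  by (auto simp: consistent_def)

text \<open>Supremum in the precision order: first components grow, second ones shrink. Intersecting
  with \<open>B\<close> gives the empty family the supremum \<open>({}, B)\<close>, the least
  precise pair.\<close>

definition Sup_p :: "'b set \<Rightarrow> ('b set \<times> 'b set) set \<Rightarrow> 'b set \<times> 'b set" where
  "Sup_p B C = (\<Union>(fst ` C), B \<inter> \<Inter>(snd ` C))"

lemma Sup_p_upper: "x \<in> C \<Longrightarrow> x \<le>\<^sub>p Sup_p B C"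
  by (auto simp: Sup_p_def le_p_def)

lemma Sup_p_least: "(\<And>x. x \<in> C \<Longrightarrow> x \<le>\<^sub>p z) \<Longrightarrow> snd z \<subseteq> B \<Longrightarrow> Sup_p B C \<le>\<^sub>p z"
  by (fastforce simp: Sup_p_def le_p_def)

definition chain_p :: "('b set \<times> 'b set) set \<Rightarrow> bool" where
  "chain_p C \<longleftrightarrow> (\<forall>x\<in>C. \<forall>y\<in>C. x \<le>\<^sub>p y \<or> y \<le>\<^sub>p x)"

text \<open>If \<open>w\<close> is the more precise of two members \<open>x\<close> and
  \<open>y\<close> of the chain, then \<open>fst x\<close> \<subseteq> \<open>fst w\<close>
  \<subseteq> \<open>snd w\<close> \<subseteq> \<open>snd y\<close>.\<close>

lemma Sup_p_consistent:
  assumes "chain_p C" "C \<subseteq> consistent B"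
  shows "Sup_p B C \<in> consistent B"
proof -
  have "fst x \<subseteq> snd y" if "x \<in> C" "y \<in> C" for x y
  proof -
    have "fst x \<subseteq> snd x" "fst y \<subseteq> snd y"
      using subsetD[OF assms(2)] that by (auto simp only: consistent_iff)
    then show ?thesis
      using assms(1) that unfolding chain_p_def le_p_def by blast
  qed
  moreover have "fst x \<subseteq> B" if "x \<in> C" for x
    using subsetD[OF assms(2) that] unfolding consistent_iff by blast
  ultimately show ?thesis
    unfolding Sup_p_def consistent_iff fst_conv snd_conv by blast
qed

text \<open>The third conclusion is induction along the iteration in a form without ordinals. The
  bound \<open>z\<close> may lie outside \<open>X\<close>, so that it can be a fixpoint of another
  operator with a different set of prudent pairs.\<close>

lemma chain_complete_fixpoint:
  fixes X :: "('b set \<times> 'b set) set"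
  assumes Sup_X: "\<And>C. chain_p C \<Longrightarrow> C \<subseteq> X \<Longrightarrow> Sup_p B C \<in> X"
    and X_B: "\<And>x. x \<in> X \<Longrightarrow> snd x \<subseteq> B"
    and F_X: "\<And>x. x \<in> X \<Longrightarrow> F x \<in> X"
    and F_mono: "\<And>x y. x \<in> X \<Longrightarrow> y \<in> X \<Longrightarrow> x \<le>\<^sub>p y \<Longrightarrow> F x \<le>\<^sub>p F y"
  obtains x where "x \<in> X" "F x = x"
    "\<forall>z. snd z \<subseteq> B \<longrightarrow> (\<forall>y\<in>X. y \<le>\<^sub>p z \<longrightarrow> F y \<le>\<^sub>p z) \<longrightarrow> x \<le>\<^sub>p z"
proof -
  define Z where "Z = {z. snd z \<subseteq> B \<and> (\<forall>y\<in>X. y \<le>\<^sub>p z \<longrightarrow> F y \<le>\<^sub>p z)}"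
  define Y where "Y = {x \<in> X. x \<le>\<^sub>p F x \<and> (\<forall>z\<in>Z. x \<le>\<^sub>p z)}"
  have "\<exists>m\<in>Y. \<forall>a\<in>Y. m \<le>\<^sub>p a \<longrightarrow> a = m"
  proof (rule predicate_Zorn)
    show "partial_order_on Y (relation_of (\<le>\<^sub>p) Y)"
      by (rule partial_order_on_relation_ofI)
        (use le_p_refl le_p_trans le_p_antisym in blast)+
  next
    \<comment> \<open>The empty chain counts here; its supremum is the starting point of the
      iteration and shows that \<open>Y\<close> is inhabited.\<close>
    fix C assume C: "C \<in> Chains (relation_of (\<le>\<^sub>p) Y)"
    then have CY: "C \<subseteq> Y" and chain: "chain_p C"
      by (auto simp: Chains_def relation_of_def chain_p_def)
    then have SX: "Sup_p B C \<in> X"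
      using Sup_X Y_def by blast
    have "Sup_p B C \<le>\<^sub>p F (Sup_p B C)"
    proof (rule Sup_p_least)
      fix x assume "x \<in> C"
      then have "x \<in> X" "x \<le>\<^sub>p F x"
        using CY Y_def by auto
      moreover have "F x \<le>\<^sub>p F (Sup_p B C)"
        using F_mono SX Sup_p_upper \<open>x \<in> C\<close> \<open>x \<in> X\<close> by blast
      ultimately show "x \<le>\<^sub>p F (Sup_p B C)"
        using le_p_trans by blast
    qed (simp add: X_B F_X SX)
    moreover have "Sup_p B C \<le>\<^sub>p z" if "z \<in> Z" for z
    proof (rule Sup_p_least)
      show "snd z \<subseteq> B"
        using that by (simp add: Z_def)
      show "x \<le>\<^sub>p z" if "x \<in> C" for x
        using \<open>x \<in> C\<close> \<open>z \<in> Z\<close> CY by (auto simp: Y_def)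
    qed
    ultimately have "Sup_p B C \<in> Y"
      using SX by (simp add: Y_def)
    then show "\<exists>u\<in>Y. \<forall>a\<in>C. a \<le>\<^sub>p u"
      using Sup_p_upper by blast
  qed
  then obtain m where m: "m \<in> Y" and max: "\<And>a. a \<in> Y \<Longrightarrow> m \<le>\<^sub>p a \<Longrightarrow> a = m"
    by blast
  \<comment> \<open>Monotonicity turns \<open>m \<le>\<^sub>p F m\<close> into
    \<open>F m \<le>\<^sub>p F (F m)\<close>, and no \<open>z\<close> in \<open>Z\<close> is passed.
    Maximality then collapses \<open>m \<le>\<^sub>p F m\<close> to equality.\<close>
  have "F m \<in> Y"
    using m F_X F_mono by (simp add: Y_def Z_def)
  then have "F m = m"
    using m max by (simp add: Y_def)
  with m show thesis
    using that unfolding Y_def Z_def by blast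
qed

lemma The_least_p_fixpoint:
  assumes "least_p_fixpoint X F x"
  shows "(THE x. least_p_fixpoint X F x) = x"
  using assms by (intro the_equality) (auto simp: least_p_fixpoint_def intro: le_p_antisym)

section \<open>Approximating operators\<close>

text \<open>Since inconsistent pairs are unconstrained, \<open>fst (A (x, b))\<close> is monotone in
  \<open>x\<close> only below \<open>b\<close>, where a prefixpoint may fail to exist; for
  \<open>snd (A (a, x))\<close> the set \<open>B\<close> is always one.\<close>

locale approximator =
  fixes B :: "'b set" and A :: "'b set \<times> 'b set \<Rightarrow> 'b set \<times> 'b set"
  assumes consistent: "x \<in> consistent B \<Longrightarrow> A x \<in> consistent B"
    and mono: "x \<in> consistent B \<Longrightarrow> y \<in> consistent B \<Longrightarrow> x \<le>\<^sub>p y \<Longrightarrow> A x \<le>\<^sub>p A y"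
begin

lemma fst_mono:
  "a \<subseteq> a' \<Longrightarrow> a' \<subseteq> b' \<Longrightarrow> b' \<subseteq> b \<Longrightarrow> b \<subseteq> B \<Longrightarrow> fst (A (a, b)) \<subseteq> fst (A (a', b'))"
  using mono[of "(a, b)" "(a', b')"] by (auto simp: consistent_iff le_p_def)

lemma snd_antimono:
  "a \<subseteq> a' \<Longrightarrow> a' \<subseteq> b' \<Longrightarrow> b' \<subseteq> b \<Longrightarrow> b \<subseteq> B \<Longrightarrow> snd (A (a', b')) \<subseteq> snd (A (a, b))"
  using mono[of "(a, b)" "(a', b')"] by (auto simp: consistent_iff le_p_def)

lemma fst_le_snd: "a \<subseteq> b \<Longrightarrow> b \<subseteq> B \<Longrightarrow> fst (A (a, b)) \<subseteq> snd (A (a, b))"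
  using consistent[of "(a, b)"] by (auto simp: consistent_iff)

section \<open>Least prefixpoints of the two component operators\<close>

lemma down_op_antimono: "b \<subseteq> b' \<Longrightarrow> b' \<subseteq> B \<Longrightarrow> down_op B A b' \<subseteq> down_op B A b"
proof -
  assume b: "b \<subseteq> b'" "b' \<subseteq> B"
  have "{x. x \<subseteq> b \<and> fst (A (x, b)) \<subseteq> x} \<subseteq> {x. x \<subseteq> b' \<and> fst (A (x, b')) \<subseteq> x}"
    using fst_mono[OF order_refl _ b] b(1) by blast
  then show ?thesis
    unfolding down_op_def by (intro Int_mono Inter_anti_mono order_refl)
qed

text \<open>Knaster-Tarski. The given prefixpoint \<open>x\<close> puts the intersection below
  \<open>b\<close>; over an empty family it would be all of \<open>B\<close>, and
  \<open>(B, b)\<close> need not be consistent.\<close>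

lemma down_op_prefixpoint:
  assumes "x \<subseteq> b" "fst (A (x, b)) \<subseteq> x" "b \<subseteq> B"
  shows "fst (A (down_op B A b, b)) \<subseteq> down_op B A b"
proof -
  have "fst (A (down_op B A b, b)) \<subseteq> y" if "y \<subseteq> b" "fst (A (y, b)) \<subseteq> y" for y
  proof -
    have "down_op B A b \<subseteq> y"
      using that by (auto simp: down_op_def)
    then show ?thesis
      using fst_mono[of "down_op B A b" y b b] that assms by blast
  qed
  moreover have "x \<subseteq> B"
    using assms by blast
  ultimately show ?thesis
    using assms unfolding down_op_def by blast
qed

text \<open>The image of the least prefixpoint is again a prefixpoint below \<open>b\<close>, hence
  contains the least one.\<close>

lemma down_op_postfixpoint:
  assumes "x \<subseteq> b" "fst (A (x, b)) \<subseteq> x" "b \<subseteq> B"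
  shows "down_op B A b \<subseteq> fst (A (down_op B A b, b))"
proof -
  let ?l = "down_op B A b"
  have l: "?l \<subseteq> b"
    using assms by (auto simp: down_op_def)
  have pre: "fst (A (?l, b)) \<subseteq> ?l"
    by (rule down_op_prefixpoint[OF assms])
  then have "fst (A (fst (A (?l, b)), b)) \<subseteq> fst (A (?l, b))"
    by (rule fst_mono) (use l assms in auto)
  moreover have "fst (A (?l, b)) \<subseteq> b"
    using pre l by blast
  ultimately show ?thesis
    by (subst down_op_def) blast
qed

lemma up_op_prefixpoint: "a \<subseteq> B \<Longrightarrow> snd (A (a, up_op B A a)) \<subseteq> up_op B A a"
proof -
  assume a: "a \<subseteq> B"
  have "snd (A (a, up_op B A a)) \<subseteq> y" if "a \<subseteq> y" "y \<subseteq> B" "snd (A (a, y)) \<subseteq> y" for y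
  proof -
    have "a \<subseteq> up_op B A a" "up_op B A a \<subseteq> y"
      using that a by (auto simp: up_op_def)
    then show ?thesis
      using snd_antimono[of a a "up_op B A a" y] that by blast
  qed
  \<comment> \<open>Thus \<open>B\<close> belongs to the family, and the bound above for
    \<open>y = B\<close> puts the left side inside \<open>B\<close>.\<close>
  moreover have "snd (A (a, B)) \<subseteq> B"
    using consistent[of "(a, B)"] a by (auto simp: consistent_iff)
  ultimately show ?thesis
    using a by (subst (2) up_op_def) blast
qed

text \<open>The set \<open>y \<inter> b\<close> is a prefixpoint of the lower operator at
  \<open>b\<close>, because lower and upper values are comparable at exact pairs. With
  \<open>c = a\<close> this makes the stable pair consistent; with smaller \<open>c\<close> it makes
  \<open>up_op\<close> antimonotone.\<close>

lemma down_op_le_upper_prefixpoint: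
  assumes "(a, b) \<in> prudent B A" "c \<subseteq> a" "c \<subseteq> y" "y \<subseteq> B" "snd (A (c, y)) \<subseteq> y"
  shows "down_op B A b \<subseteq> y"
proof -
  have ab: "a \<subseteq> b" "b \<subseteq> B" "snd (A (a, b)) \<subseteq> b"
    using assms(1) by (auto simp: prudent_def consistent_iff le_p_def)
  \<comment> \<open>the exact pair \<open>(?e, ?e)\<close> refines both \<open>(c, y)\<close> and \<open>(?e, b)\<close>\<close>
  let ?e = "y \<inter> b"
  have "fst (A (?e, b)) \<subseteq> fst (A (?e, ?e))"
    by (rule fst_mono) (use ab in auto)
  also have "\<dots> \<subseteq> snd (A (?e, ?e))"
    by (rule fst_le_snd) (use ab in auto)
  also have "\<dots> \<subseteq> snd (A (c, y))"
    by (rule snd_antimono) (use ab assms in auto)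
  finally have 1: "fst (A (?e, b)) \<subseteq> y"
    using assms by blast
  \<comment> \<open>The exact pair \<open>(b, b)\<close> refines both \<open>(?e, b)\<close> and
    \<open>(a, b)\<close>, and prudence bounds the upper value at \<open>(a, b)\<close> by
    \<open>b\<close>.\<close>
  have "fst (A (?e, b)) \<subseteq> fst (A (b, b))"
    by (rule fst_mono) (use ab in auto)
  also have "\<dots> \<subseteq> snd (A (b, b))"
    by (rule fst_le_snd) (use ab in auto)
  also have "\<dots> \<subseteq> snd (A (a, b))"
    by (rule snd_antimono) (use ab in auto)
  finally have "fst (A (?e, b)) \<subseteq> ?e"
    using 1 ab by blast
  then show ?thesis
    unfolding down_op_def by blast
qed

text \<open>Raising \<open>c\<close> to \<open>a\<close> lowers the upper values but also discards
  candidates that do not contain \<open>a\<close>. Prudence ensures that no prefixpoint is lost: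
  each one contains \<open>down_op B A b\<close>, hence \<open>a\<close>.\<close>

lemma up_op_antimono:
  assumes "(a, b) \<in> prudent B A" "c \<subseteq> a"
  shows "up_op B A a \<subseteq> up_op B A c"
proof -
  have ab: "a \<subseteq> b" "b \<subseteq> B" "a \<subseteq> down_op B A b"
    using assms(1) by (auto simp: prudent_def consistent_iff)
  have "a \<subseteq> y \<and> snd (A (a, y)) \<subseteq> y" if y: "c \<subseteq> y" "y \<subseteq> B" "snd (A (c, y)) \<subseteq> y" for y
  proof
    show "a \<subseteq> y"
      using down_op_le_upper_prefixpoint[OF assms y] ab by blast
    then show "snd (A (a, y)) \<subseteq> y"
      using snd_antimono[OF assms(2), of y y] y by blast
  qed
  then have "{x. c \<subseteq> x \<and> x \<subseteq> B \<and> snd (A (c, x)) \<subseteq> x}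
      \<subseteq> {x. a \<subseteq> x \<and> x \<subseteq> B \<and> snd (A (a, x)) \<subseteq> x}"
    by blast
  then show ?thesis
    unfolding up_op_def by (intro Int_mono Inter_anti_mono order_refl)
qed

lemma stable_op_mono:
  assumes "x \<in> prudent B A" "y \<in> prudent B A" "x \<le>\<^sub>p y"
  shows "stable_op B A x \<le>\<^sub>p stable_op B A y"
proof -
  have "snd x \<subseteq> B" "fst x \<subseteq> fst y" "snd y \<subseteq> snd x"
    using assms by (auto simp: prudent_def consistent_iff le_p_def)
  then show ?thesis
    using up_op_antimono[of "fst y" "snd y" "fst x"] down_op_antimono[of "snd y" "snd x"] assms(2)
    by (simp add: stable_op_def le_p_def)
qed

text \<open>The set \<open>?l\<close> is a fixpoint of the lower operator at \<open>b\<close>, and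
  shrinking \<open>b\<close> to \<open>?u\<close> raises lower values; \<open>?u\<close> is a
  prefixpoint of the upper operator at \<open>a\<close>, and growing \<open>a\<close> to
  \<open>?l\<close> lowers upper values.\<close>

lemma stable_op_prudent:
  assumes "x \<in> prudent B A"
  shows "stable_op B A x \<in> prudent B A"
proof -
  obtain a b where x: "x = (a, b)"
    by (cases x)
  let ?l = "down_op B A b" and ?u = "up_op B A a"
  have ab: "a \<subseteq> b" "b \<subseteq> B" "snd (A (a, b)) \<subseteq> b" "a \<subseteq> ?l"
    using assms by (auto simp: x prudent_def consistent_iff le_p_def)
  \<comment> \<open>Prudence makes \<open>b\<close> itself a member of the family that defines
    \<open>?u\<close>.\<close>
  have u: "?u \<subseteq> b" "a \<subseteq> ?u"
    using ab by (auto simp: up_op_def)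
  have "snd (A (a, ?u)) \<subseteq> ?u"
    by (rule up_op_prefixpoint) (use ab in auto)
  then have lu: "?l \<subseteq> ?u"
    using down_op_le_upper_prefixpoint[of a b a ?u] assms u ab by (simp add: x)
  have "fst (A (b, b)) \<subseteq> b"
    using fst_le_snd[of b b] snd_antimono[of a b b b] ab by blast
  then have "?l \<subseteq> fst (A (?l, b))"
    using down_op_postfixpoint[of b b] ab by blast
  also have "\<dots> \<subseteq> fst (A (?l, ?u))"
    by (rule fst_mono) (use ab lu u in auto)
  finally have 1: "?l \<subseteq> fst (A (?l, ?u))" .
  have "snd (A (?l, ?u)) \<subseteq> snd (A (a, ?u))"
    by (rule snd_antimono) (use ab lu u in auto)
  then have 2: "snd (A (?l, ?u)) \<subseteq> ?u"
    using \<open>snd (A (a, ?u)) \<subseteq> ?u\<close> by blast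
  have "?l \<subseteq> down_op B A ?u"
    by (rule down_op_antimono) (use ab u in auto)
  with 1 2 lu u ab show ?thesis
    by (auto simp: x stable_op_def prudent_def consistent_iff le_p_def)
qed

text \<open>Both conditions pass to the supremum:
  \<open>x \<le>\<^sub>p A x \<le>\<^sub>p A ?s\<close> for each member \<open>x\<close>, and
  \<open>down_op\<close> grows when \<open>snd x\<close> shrinks to \<open>snd ?s\<close>.\<close>

lemma Sup_p_prudent:
  assumes "chain_p C" "C \<subseteq> prudent B A"
  shows "Sup_p B C \<in> prudent B A"
proof -
  let ?s = "Sup_p B C"
  have C: "C \<subseteq> consistent B"
    using assms(2) by (auto simp: prudent_def)
  have s: "?s \<in> consistent B"
    by (rule Sup_p_consistent[OF assms(1) C])
  have "?s \<le>\<^sub>p A ?s"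
  proof (rule Sup_p_least)
    fix x assume "x \<in> C"
    then have "x \<le>\<^sub>p A x" "A x \<le>\<^sub>p A ?s"
      using assms(2) C s Sup_p_upper mono unfolding prudent_def by blast+
    then show "x \<le>\<^sub>p A ?s"
      by (rule le_p_trans)
  qed (use consistent[OF s] in \<open>auto simp: consistent_iff\<close>)
  moreover have "fst x \<subseteq> down_op B A (snd ?s)" if "x \<in> C" for x
  proof -
    have "snd ?s \<subseteq> snd x" "snd x \<subseteq> B" "fst x \<subseteq> down_op B A (snd x)"
      using that assms(2) Sup_p_upper[OF that, of B]
      by (auto simp: prudent_def consistent_iff le_p_def)
    then show ?thesis
      using down_op_antimono by blast
  qed
  then have "fst ?s \<subseteq> down_op B A (snd ?s)"
    by (subst Sup_p_def) auto
  ultimately show ?thesis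
    using s by (simp add: prudent_def)
qed

section \<open>Existence and leastness of the Kripke-Kleene and well-founded fixpoints\<close>

lemma kk_fixpoint:
  shows kk_fixpoint_consistent: "kk_fixpoint B A \<in> consistent B"
    and kk_fixpoint_fixpoint: "A (kk_fixpoint B A) = kk_fixpoint B A"
    and kk_fixpoint_le: "\<And>z. snd z \<subseteq> B \<Longrightarrow>
      (\<And>y. y \<in> consistent B \<Longrightarrow> y \<le>\<^sub>p z \<Longrightarrow> A y \<le>\<^sub>p z) \<Longrightarrow> kk_fixpoint B A \<le>\<^sub>p z"
proof -
  have B: "snd x \<subseteq> B" if "x \<in> consistent B" for x
    using that by (auto simp: consistent_iff)
  obtain x where x: "x \<in> consistent B" "A x = x"
    and le: "\<forall>z. snd z \<subseteq> B \<longrightarrow> (\<forall>y\<in>consistent B. y \<le>\<^sub>p z \<longrightarrow> A y \<le>\<^sub>p z) \<longrightarrow> x \<le>\<^sub>p z"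
    by (rule chain_complete_fixpoint[of "consistent B" B A, OF Sup_p_consistent B consistent mono])
  \<comment> \<open>By monotonicity \<open>A\<close> does not lead past its own fixpoint
    \<open>y\<close>, so \<open>le\<close> applies with \<open>z = y\<close>.\<close>
  have "x \<le>\<^sub>p y" if "y \<in> consistent B" "A y = y" for y
    using le[rule_format, OF B[OF that(1)]] mono[OF _ that(1)] that(2) by simp
  then have "least_p_fixpoint (consistent B) A x"
    using x by (simp add: least_p_fixpoint_def)
  then have "kk_fixpoint B A = x"
    unfolding kk_fixpoint_def by (rule The_least_p_fixpoint)
  with x le[rule_format] show "kk_fixpoint B A \<in> consistent B"
    "A (kk_fixpoint B A) = kk_fixpoint B A"
    "\<And>z. snd z \<subseteq> B \<Longrightarrow>
      (\<And>y. y \<in> consistent B \<Longrightarrow> y \<le>\<^sub>p z \<Longrightarrow> A y \<le>\<^sub>p z) \<Longrightarrow> kk_fixpoint B A \<le>\<^sub>p z"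
    by metis+
qed

lemma wf_fixpoint:
  shows wf_fixpoint_prudent: "wf_fixpoint B A \<in> prudent B A"
    and wf_fixpoint_fixpoint: "stable_op B A (wf_fixpoint B A) = wf_fixpoint B A"
    and wf_fixpoint_le: "\<And>z. snd z \<subseteq> B \<Longrightarrow>
      (\<And>y. y \<in> prudent B A \<Longrightarrow> y \<le>\<^sub>p z \<Longrightarrow> stable_op B A y \<le>\<^sub>p z) \<Longrightarrow> wf_fixpoint B A \<le>\<^sub>p z"
proof -
  have B: "snd x \<subseteq> B" if "x \<in> prudent B A" for x
    using that by (auto simp: prudent_def consistent_iff)
  obtain x where x: "x \<in> prudent B A" "stable_op B A x = x"
    and le: "\<forall>z. snd z \<subseteq> B \<longrightarrow> (\<forall>y\<in>prudent B A. y \<le>\<^sub>p z \<longrightarrow> stable_op B A y \<le>\<^sub>p z) \<longrightarrow> x \<le>\<^sub>p z"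
    by (rule chain_complete_fixpoint[of "prudent B A" B "stable_op B A",
        OF Sup_p_prudent B stable_op_prudent stable_op_mono])
  have "x \<le>\<^sub>p y" if "y \<in> prudent B A" "stable_op B A y = y" for y
    using le[rule_format, OF B[OF that(1)]] stable_op_mono[OF _ that(1)] that(2) by simp
  then have "least_p_fixpoint (prudent B A) (stable_op B A) x"
    using x by (simp add: least_p_fixpoint_def)
  then have "wf_fixpoint B A = x"
    unfolding wf_fixpoint_def by (rule The_least_p_fixpoint)
  with x le[rule_format] show "wf_fixpoint B A \<in> prudent B A"
    "stable_op B A (wf_fixpoint B A) = wf_fixpoint B A"
    "\<And>z. snd z \<subseteq> B \<Longrightarrow>
      (\<And>y. y \<in> prudent B A \<Longrightarrow> y \<le>\<^sub>p z \<Longrightarrow> stable_op B A y \<le>\<^sub>p z) \<Longrightarrow> wf_fixpoint B A \<le>\<^sub>p z"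
    by metis+
qed

end

section \<open>Comparison of two operators of different precision\<close>

locale approximator_le = A1: approximator B A1 + A2: approximator B A2
  for B :: "'b set" and A1 A2 +
  assumes le: "x \<in> consistent B \<Longrightarrow> A1 x \<le>\<^sub>p A2 x"
begin

text \<open>The first operator cannot pass the fixpoint \<open>?z\<close> of the second:
  \<open>A1 y \<le>\<^sub>p A2 y \<le>\<^sub>p A2 ?z = ?z\<close>.\<close>

lemma kk_fixpoint_mono: "kk_fixpoint B A1 \<le>\<^sub>p kk_fixpoint B A2"
proof (rule A1.kk_fixpoint_le)
  let ?z = "kk_fixpoint B A2"
  show "snd ?z \<subseteq> B"
    using A2.kk_fixpoint_consistent by (auto simp: consistent_iff)
  fix y assume y: "y \<in> consistent B" "y \<le>\<^sub>p ?z"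
  have "A1 y \<le>\<^sub>p A2 y"
    by (rule le[OF y(1)])
  also have "A2 y \<le>\<^sub>p A2 ?z"
    by (rule A2.mono[OF y(1) A2.kk_fixpoint_consistent y(2)])
  finally (le_p_trans) show "A1 y \<le>\<^sub>p ?z"
    by (simp add: A2.kk_fixpoint_fixpoint)
qed

text \<open>Larger lower values leave fewer prefixpoints, so the intersection grows.\<close>

lemma down_op_le: "b \<subseteq> B \<Longrightarrow> down_op B A1 b \<subseteq> down_op B A2 b"
proof -
  assume b: "b \<subseteq> B"
  have "fst (A1 (x, b)) \<subseteq> fst (A2 (x, b))" if "x \<subseteq> b" for x
    using le[of "(x, b)"] that b by (auto simp: consistent_iff le_p_def)
  then have "{x. x \<subseteq> b \<and> fst (A2 (x, b)) \<subseteq> x} \<subseteq> {x. x \<subseteq> b \<and> fst (A1 (x, b)) \<subseteq> x}"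
    by blast
  then show ?thesis
    unfolding down_op_def by (intro Int_mono Inter_anti_mono order_refl)
qed

lemma up_op_ge: "up_op B A2 a \<subseteq> up_op B A1 a"
proof -
  have "snd (A2 (a, x)) \<subseteq> snd (A1 (a, x))" if "a \<subseteq> x" "x \<subseteq> B" for x
    using le[of "(a, x)"] that by (auto simp: consistent_iff le_p_def)
  then have "{x. a \<subseteq> x \<and> x \<subseteq> B \<and> snd (A1 (a, x)) \<subseteq> x}
      \<subseteq> {x. a \<subseteq> x \<and> x \<subseteq> B \<and> snd (A2 (a, x)) \<subseteq> x}"
    by blast
  then show ?thesis
    unfolding up_op_def by (intro Int_mono Inter_anti_mono order_refl)
qed

lemma stable_op_le: "snd x \<subseteq> B \<Longrightarrow> stable_op B A1 x \<le>\<^sub>p stable_op B A2 x"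
  by (simp add: stable_op_def le_p_def down_op_le up_op_ge)

lemma prudent_subset: "prudent B A1 \<subseteq> prudent B A2"
proof
  fix x assume x: "x \<in> prudent B A1"
  then have *: "x \<in> consistent B" "x \<le>\<^sub>p A1 x" "fst x \<subseteq> down_op B A1 (snd x)" "snd x \<subseteq> B"
    by (auto simp: prudent_def consistent_iff)
  have "x \<le>\<^sub>p A2 x"
    by (rule le_p_trans[OF *(2) le[OF *(1)]])
  moreover have "fst x \<subseteq> down_op B A2 (snd x)"
    using *(3) down_op_le[OF *(4)] by blast
  ultimately show "x \<in> prudent B A2"
    using *(1) by (simp add: prudent_def)
qed

lemma wf_fixpoint_mono: "wf_fixpoint B A1 \<le>\<^sub>p wf_fixpoint B A2"
proof (rule A1.wf_fixpoint_le)
  let ?z = "wf_fixpoint B A2"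
  show "snd ?z \<subseteq> B"
    using A2.wf_fixpoint_prudent by (auto simp: prudent_def consistent_iff)
  fix y assume y: "y \<in> prudent B A1" "y \<le>\<^sub>p ?z"
  have "stable_op B A1 y \<le>\<^sub>p stable_op B A2 y"
    by (rule stable_op_le) (use y(1) in \<open>auto simp: prudent_def consistent_iff\<close>)
  \<comment> \<open>The pair \<open>y\<close> is prudent for \<open>A2\<close> as well, which makes
    the monotonicity of the second stable operator available.\<close>
  also have "stable_op B A2 y \<le>\<^sub>p stable_op B A2 ?z"
    using A2.stable_op_mono A2.wf_fixpoint_prudent prudent_subset y by blast
  finally (le_p_trans) show "stable_op B A1 y \<le>\<^sub>p ?z"
    by (simp add: A2.wf_fixpoint_fixpoint)
qed

text \<open>Comparing the operators gives \<open>I\<close> \<subseteq> \<open>down_op B A2 I\<close>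
  and \<open>up_op B A2 I\<close> \<subseteq> \<open>I\<close>. For the converses, \<open>I\<close>
  is a prefixpoint of the lower operator of \<open>A2\<close> unless the family for
  \<open>A1\<close> is empty, and every candidate for \<open>up_op\<close> contains
  \<open>I\<close>.\<close>

lemma exact_stable_fixpoint_mono:
  assumes exact: "fst (A1 (I, I)) = snd (A1 (I, I))"
    and stable: "exact_stable_fixpoint B A1 I"
  shows "exact_stable_fixpoint B A2 I"
proof -
  have I: "I \<subseteq> B" "down_op B A1 I = I" "up_op B A1 I = I"
    using stable by (auto simp: exact_stable_fixpoint_def stable_op_def)
  \<comment> \<open>Consistency of \<open>A2 (I, I)\<close> and exactness of
    \<open>A1 (I, I)\<close> squeeze the lower value of \<open>A2\<close> through the two upper
    values.\<close>
  have eq: "fst (A2 (I, I)) \<subseteq> fst (A1 (I, I))"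
    using exact le[of "(I, I)"] A2.fst_le_snd[of I I] I(1) by (auto simp: consistent_iff le_p_def)
  have "down_op B A2 I \<subseteq> I"
  proof (cases "\<exists>x. x \<subseteq> I \<and> fst (A1 (x, I)) \<subseteq> x")
    case True
    then obtain x where "x \<subseteq> I" "fst (A1 (x, I)) \<subseteq> x"
      by blast
    from A1.down_op_prefixpoint[OF this I(1)] have "fst (A1 (I, I)) \<subseteq> I"
      by (simp add: I(2))
    then have "fst (A2 (I, I)) \<subseteq> I"
      using eq by (rule order_trans[rotated])
    then show ?thesis
      unfolding down_op_def by blast
  next
    case False
    \<comment> \<open>the glb of the empty family is \<open>B\<close>\<close>
    then have "I = B"
      using I(2) unfolding down_op_def by blast
    then show ?thesis
      by (simp add: down_op_def)
  qed
  moreover have "I \<subseteq> down_op B A2 I"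
    using down_op_le[of I] I by blast
  moreover have "up_op B A2 I \<subseteq> I"
    using up_op_ge[of I] I by blast
  moreover have "I \<subseteq> up_op B A2 I"
    using I(1) unfolding up_op_def by blast
  ultimately show ?thesis
    using I(1) by (auto simp: exact_stable_fixpoint_def stable_op_def)
qed

end

section \<open>Three-valued evaluation\<close>

lemma THREE_iff: "v \<in> THREE \<longleftrightarrow> (fst v \<longrightarrow> snd v)"
  by (cases v) (auto simp: THREE_def)

section \<open>Sorts of terms and independence of the aggregates\<close>

lemma has_sort_extend_sig: "has_sort (extend_sig \<Sigma> \<Pi>) t s \<Longrightarrow> has_sort \<Sigma> t s"
proof (induction rule: has_sort.induct)
  case (2 f ss s ts)
  have "list_all2 (has_sort \<Sigma>) ts ss"
    by (rule list_all2_mono[OF 2(2)]) auto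
  with 2(1) show ?case
    by (auto simp: extend_sig_def intro: has_sort.intros)
qed (auto simp: extend_sig_def intro: has_sort.intros)

lemma sorted_on_Un: "sorted_on D (X \<union> Y) \<theta> \<longleftrightarrow> sorted_on D X \<theta> \<and> sorted_on D Y \<theta>"
  by (auto simp: sorted_on_def)

text \<open>Aggregate relations are constrained only at values in the sort domain, so the term of an
  aggregate atom has to be located there.\<close>

lemma eval_trm_sorted:
  assumes "is_structure \<Sigma> D"
  shows "has_sort \<Sigma> t s \<Longrightarrow> sorted_on D (fv_trm t) \<theta> \<Longrightarrow> eval_trm D \<theta> t \<in> sdom D s"
proof (induction rule: has_sort.induct)
  case (2 f ss s ts)
  have "sorted_on D (fv_trm (ts ! i)) \<theta>" if "i < length ts" for i
    using 2(3) nth_mem[OF that] by (auto simp: sorted_on_def)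
  then have "map (eval_trm D \<theta>) ts \<in> tuples D ss"
    using 2(2) by (simp add: tuples_def list_all2_conv_all_nth)
  then show ?case
    using assms 2(1) by (auto simp: is_structure_def)
qed (auto simp: sorted_on_def)

lemma eval_trm_cong:
  assumes "fint D = fint D'"
  shows "eval_trm D = eval_trm D'"
proof (intro ext)
  show "eval_trm D \<theta> t = eval_trm D' \<theta> t" for \<theta> t
    using assms by (induction t) (auto cong: map_cong)
qed

lemma approximates_structure_cong:
  assumes "approximates_structure \<Sigma> D3 D"
  shows "sdom D3 = sdom D" "pint D3 = pint D" "tuples D3 = tuples D" "eval_trm D3 = eval_trm D"
    "variants D3 = variants D" "base D3 = base D" "inst D3 = inst D"
proof -
  show sdom: "sdom D3 = sdom D" and "pint D3 = pint D"
    using assms by (simp_all add: approximates_structure_def)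
  have fint: "fint D3 = fint D"
    using assms by (simp add: approximates_structure_def)
  show tuples: "tuples D3 = tuples D"
    by (simp add: fun_eq_iff tuples_def sdom)
  show "eval_trm D3 = eval_trm D"
    by (rule eval_trm_cong[OF fint])
  show "variants D3 = variants D"
    by (simp add: fun_eq_iff variants_def sorted_on_def sdom)
  show "base D3 = base D"
    by (simp add: fun_eq_iff base_def tuples)
  show "inst D3 = inst D"
    by (simp add: fun_eq_iff inst_def sorted_on_def sdom eval_trm_cong[OF fint])
qed

lemma variants_sorted:
  "\<theta>' \<in> variants D X \<theta> \<Longrightarrow> sorted_on D (Y - X) \<theta> \<Longrightarrow> sorted_on D Y \<theta>'"
  unfolding variants_def sorted_on_def by (metis (mono_tags, lifting) DiffI mem_Collect_eq)

lemma variants_tuples: "\<theta>' \<in> variants D (set xs) \<theta> \<Longrightarrow> map \<theta>' xs \<in> tuples D (map snd xs)"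
  by (auto simp: variants_def sorted_on_def tuples_def list_all2_conv_all_nth)

text \<open>Membership in \<open>THREE\<close> is carried through the induction because it makes the
  values of set expressions consistent, and aggregate relations are monotone only between consistent
  sets.\<close>

lemma
  fixes \<phi> :: "('v, 's, 'f, 'p, 'a) formula" and S :: "('v, 's, 'f, 'p, 'a) set_expr"
  assumes D: "is_structure \<Sigma> D"
    and D1: "approximates_structure \<Sigma> D1 D"
    and D2: "approximates_structure \<Sigma> D2 D"
    and le: "le_structure \<Sigma> D1 D2"
    and I: "fst I \<subseteq> snd I" and J: "fst J \<subseteq> snd J" and IJ: "I \<le>\<^sub>p J"
  shows eval_mono: "wf_formula (extend_sig \<Sigma> \<Pi>) \<phi> \<Longrightarrow> sorted_on D (fv \<phi>) \<theta> \<Longrightarrow>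
      eval D1 \<Pi> I \<phi> \<theta> \<in> THREE \<and> eval D2 \<Pi> J \<phi> \<theta> \<in> THREE \<and> eval D1 \<Pi> I \<phi> \<theta> \<le>\<^sub>p eval D2 \<Pi> J \<phi> \<theta>"
    and eval_set_mono: "wf_set_expr (extend_sig \<Sigma> \<Pi>) S ss \<Longrightarrow> sorted_on D (fv_set_expr S) \<theta> \<Longrightarrow>
      eval_set D1 \<Pi> I S \<theta> \<in> consistent (tuples D ss) \<and>
      eval_set D2 \<Pi> J S \<theta> \<in> consistent (tuples D ss) \<and>
      eval_set D1 \<Pi> I S \<theta> \<le>\<^sub>p eval_set D2 \<Pi> J S \<theta>"
proof (induction \<phi> and S arbitrary: \<theta> and ss \<theta> rule: formula.induct set_expr.induct)
  case (Atom p ts)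
  show ?case
    using I J IJ by (auto simp: Let_def THREE_iff le_p_def
        approximates_structure_cong[OF D1] approximates_structure_cong[OF D2])
next
  case (AggAtom R S t)
  then obtain ss w where R: "agg_sig \<Sigma> R = Some (ss, w)"
    and S: "wf_set_expr (extend_sig \<Sigma> \<Pi>) S ss" and t: "has_sort \<Sigma> t w"
    by (auto simp: extend_sig_def dest: has_sort_extend_sig[unfolded extend_sig_def])
  let ?d = "eval_trm D \<theta> t" and ?S1 = "eval_set D1 \<Pi> I S \<theta>" and ?S2 = "eval_set D2 \<Pi> J S \<theta>"
  have d: "?d \<in> sdom D w"
    using eval_trm_sorted[OF D t] AggAtom.prems by (simp add: sorted_on_Un)
  have SS: "?S1 \<in> consistent (tuples D ss)" "?S2 \<in> consistent (tuples D ss)" "?S1 \<le>\<^sub>p ?S2"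
    using AggAtom.IH[OF S] AggAtom.prems by (simp_all add: sorted_on_Un)
  have "agg_relation3 (tuples D ss) (sdom D w) (aint3 D1 R)"
    "agg_relation3 (tuples D ss) (sdom D w) (aint3 D2 R)"
    using D1 D2 R by (auto simp: approximates_structure_def)
  then have "aint3 D1 R ?S1 ?d \<in> THREE" "aint3 D2 R ?S2 ?d \<in> THREE"
    "aint3 D1 R ?S1 ?d \<le>\<^sub>p aint3 D1 R ?S2 ?d"
    using SS d by (simp_all add: agg_relation3_def)
  \<comment> \<open>The value of \<open>D1\<close> at \<open>?S2\<close> is the go-between: first
    the set argument is refined within \<open>D1\<close>, then the structure is exchanged at a fixed
    argument.\<close>
  moreover have "aint3 D1 R ?S2 ?d \<le>\<^sub>p aint3 D2 R ?S2 ?d"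
    using le R SS(2) d by (simp add: le_structure_def approximates_structure_cong[OF D1])
  ultimately show ?case
    by (auto simp: approximates_structure_cong[OF D1] approximates_structure_cong[OF D2]
        intro: le_p_trans)
next
  case (Neg \<phi>)
  then show ?case
    by (auto simp: neg3_def THREE_iff le_p_def)
next
  case (Conj \<phi> \<psi>)
  then show ?case
    by (auto simp: THREE_iff le_p_def sorted_on_Un)
next
  case (Disj \<phi> \<psi>)
  then show ?case
    by (auto simp: THREE_iff le_p_def sorted_on_Un)
next
  case (Forall x \<phi>)
  have "sorted_on D (fv \<phi>) (\<theta>(x := d))" if "d \<in> sdom D (snd x)" for d
    using Forall.prems that by (auto simp: sorted_on_def)
  then show ?case
    using Forall
    by (fastforce simp: THREE_iff le_p_def fst_Inf snd_Inf
        approximates_structure_cong[OF D1] approximates_structure_cong[OF D2])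
next
  case (Exists x \<phi>)
  have "sorted_on D (fv \<phi>) (\<theta>(x := d))" if "d \<in> sdom D (snd x)" for d
    using Exists.prems that by (auto simp: sorted_on_def)
  then show ?case
    using Exists
    by (fastforce simp: THREE_iff le_p_def fst_Sup snd_Sup
        approximates_structure_cong[OF D1] approximates_structure_cong[OF D2])
next
  case (SetExpr xs \<phi>)
  have "eval D1 \<Pi> I \<phi> \<theta>' \<in> THREE \<and> eval D2 \<Pi> J \<phi> \<theta>' \<in> THREE \<and>
      eval D1 \<Pi> I \<phi> \<theta>' \<le>\<^sub>p eval D2 \<Pi> J \<phi> \<theta>'" if "\<theta>' \<in> variants D (set xs) \<theta>" for \<theta>'
    using SetExpr variants_sorted[OF that, of "fv \<phi>"] by simp
  moreover have "map \<theta>' xs \<in> tuples D ss" if "\<theta>' \<in> variants D (set xs) \<theta>" for \<theta>'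
    using variants_tuples[OF that] SetExpr.prems by simp
  \<comment> \<open>Precision adds tuples to the certain part and removes tuples from the possible
    part.\<close>
  ultimately show ?case
    by (fastforce simp: consistent_iff le_p_def THREE_iff prod_eq_iff
        approximates_structure_cong[OF D1] approximates_structure_cong[OF D2])
qed

text \<open>Exact conditions yield an exact set \<open>(X, X)\<close>, at which aggregate relations
  are two-valued; the bound by \<open>tuples D ss\<close> places \<open>X\<close> where this clause
  applies.\<close>

lemma
  fixes \<phi> :: "('v, 's, 'f, 'p, 'a) formula" and S :: "('v, 's, 'f, 'p, 'a) set_expr"
  assumes D: "is_structure \<Sigma> D" and D1: "approximates_structure \<Sigma> D1 D"
  shows eval_exact: "wf_formula (extend_sig \<Sigma> \<Pi>) \<phi> \<Longrightarrow> sorted_on D (fv \<phi>) \<theta> \<Longrightarrow>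
      fst (eval D1 \<Pi> (I, I) \<phi> \<theta>) = snd (eval D1 \<Pi> (I, I) \<phi> \<theta>)"
    and eval_set_exact: "wf_set_expr (extend_sig \<Sigma> \<Pi>) S ss \<Longrightarrow> sorted_on D (fv_set_expr S) \<theta> \<Longrightarrow>
      fst (eval_set D1 \<Pi> (I, I) S \<theta>) = snd (eval_set D1 \<Pi> (I, I) S \<theta>) \<and>
      snd (eval_set D1 \<Pi> (I, I) S \<theta>) \<subseteq> tuples D ss"
proof (induction \<phi> and S arbitrary: \<theta> and ss \<theta> rule: formula.induct set_expr.induct)
  case (Atom p ts)
  then show ?case
    by (simp add: Let_def)
next
  case (AggAtom R S t)
  then obtain ss w where R: "agg_sig \<Sigma> R = Some (ss, w)"
    and S: "wf_set_expr (extend_sig \<Sigma> \<Pi>) S ss" and t: "has_sort \<Sigma> t w"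
    by (auto simp: extend_sig_def dest: has_sort_extend_sig[unfolded extend_sig_def])
  have d: "eval_trm D1 \<theta> t \<in> sdom D w"
    using eval_trm_sorted[OF D t] AggAtom.prems
    by (simp add: sorted_on_Un approximates_structure_cong[OF D1])
  obtain X where X: "eval_set D1 \<Pi> (I, I) S \<theta> = (X, X)" "X \<subseteq> tuples D ss"
    using AggAtom.IH[OF S, of \<theta>] AggAtom.prems
    by (cases "eval_set D1 \<Pi> (I, I) S \<theta>") (auto simp: sorted_on_Un)
  have "agg_relation3 (tuples D ss) (sdom D w) (aint3 D1 R)"
    using D1 R by (auto simp: approximates_structure_def)
  then have "aint3 D1 R (X, X) (eval_trm D1 \<theta> t) \<in> {(False, False), (True, True)}"
    using X(2) d by (simp add: agg_relation3_def)
  then show ?case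
    by (auto simp: X)
next
  case (Neg \<phi>)
  then show ?case
    by (simp add: neg3_def)
next
  case (Conj \<phi> \<psi>)
  then show ?case
    by (simp add: sorted_on_Un)
next
  case (Disj \<phi> \<psi>)
  then show ?case
    by (simp add: sorted_on_Un)
next
  case (Forall x \<phi>)
  have "sorted_on D (fv \<phi>) (\<theta>(x := d))" if "d \<in> sdom D (snd x)" for d
    using Forall.prems that by (auto simp: sorted_on_def)
  then show ?case
    using Forall
    by (simp add: fst_Inf snd_Inf image_image approximates_structure_cong[OF D1])
next
  case (Exists x \<phi>)
  have "sorted_on D (fv \<phi>) (\<theta>(x := d))" if "d \<in> sdom D (snd x)" for d
    using Exists.prems that by (auto simp: sorted_on_def)
  then show ?case
    using Exists
    by (simp add: fst_Sup snd_Sup image_image approximates_structure_cong[OF D1])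
next
  case (SetExpr xs \<phi>)
  have "fst (eval D1 \<Pi> (I, I) \<phi> \<theta>') = snd (eval D1 \<Pi> (I, I) \<phi> \<theta>')"
    if "\<theta>' \<in> variants D (set xs) \<theta>" for \<theta>'
    using SetExpr variants_sorted[OF that, of "fv \<phi>"] by simp
  moreover have "map \<theta>' xs \<in> tuples D ss" if "\<theta>' \<in> variants D (set xs) \<theta>" for \<theta>'
    using variants_tuples[OF that] SetExpr.prems by simp
  ultimately show ?case
    by (fastforce simp: prod_eq_iff approximates_structure_cong[OF D1])
qed

section \<open>The operator of an aggregate program\<close>

lemma inst_sorted:
  assumes "is_program \<Sigma> \<Pi> P" "(A, \<phi>, \<theta>) \<in> inst D P"
  shows "wf_formula (extend_sig \<Sigma> \<Pi>) \<phi>" "sorted_on D (fv \<phi>) \<theta>"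
  using assms by (auto simp: is_program_def inst_def sorted_on_def)

text \<open>A supremum of truth value pairs is a componentwise existential statement, so evaluation
  results transfer rule by rule.\<close>

lemma Phi_alt:
  "Phi D \<Pi> P I =
    ({A \<in> base D \<Pi>. \<exists>\<phi> \<theta>. (A, \<phi>, \<theta>) \<in> inst D P \<and> fst (eval D \<Pi> I \<phi> \<theta>)},
     {A \<in> base D \<Pi>. \<exists>\<phi> \<theta>. (A, \<phi>, \<theta>) \<in> inst D P \<and> snd (eval D \<Pi> I \<phi> \<theta>)})"
proof -
  have Sup: "fst (Sup X) \<longleftrightarrow> (\<exists>v\<in>X. fst v)" "snd (Sup X) \<longleftrightarrow> (\<exists>v\<in>X. snd v)"
    for X :: "(bool \<times> bool) set"
    by (simp_all add: fst_Sup snd_Sup)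
  show ?thesis
    unfolding Phi_def head_value_def Sup by blast
qed

text \<open>Varying structure and interpretation together serves twice: equal structures give
  monotonicity of one operator, equal interpretations give the comparison of two.\<close>

lemma Phi_mono:
  assumes D: "is_structure \<Sigma> D" and P: "is_program \<Sigma> \<Pi> P"
    and D1: "approximates_structure \<Sigma> D1 D"
    and D2: "approximates_structure \<Sigma> D2 D"
    and le: "le_structure \<Sigma> D1 D2"
    and I: "I \<in> consistent (base D \<Pi>)" and J: "J \<in> consistent (base D \<Pi>)" and IJ: "I \<le>\<^sub>p J"
  shows "Phi D1 \<Pi> P I \<in> consistent (base D \<Pi>) \<and> Phi D1 \<Pi> P I \<le>\<^sub>p Phi D2 \<Pi> P J"
proof -
  have IJ': "fst I \<subseteq> snd I" "fst J \<subseteq> snd J"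
    using I J by (auto simp: consistent_iff)
  have "eval D1 \<Pi> I \<phi> \<theta> \<in> THREE \<and> eval D1 \<Pi> I \<phi> \<theta> \<le>\<^sub>p eval D2 \<Pi> J \<phi> \<theta>"
    if "(A, \<phi>, \<theta>) \<in> inst D P" for A \<phi> \<theta>
    using eval_mono[OF D D1 D2 le IJ' IJ inst_sorted[OF P that]] by blast
  then show ?thesis
    unfolding Phi_alt consistent_iff le_p_def THREE_iff le_bool_def fst_conv snd_conv
      approximates_structure_cong[OF D1] approximates_structure_cong[OF D2]
    by blast
qed

lemma Phi_exact:
  assumes D: "is_structure \<Sigma> D" and P: "is_program \<Sigma> \<Pi> P"
    and D1: "approximates_structure \<Sigma> D1 D"
  shows "fst (Phi D1 \<Pi> P (I, I)) = snd (Phi D1 \<Pi> P (I, I))"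
proof -
  have "fst (eval D1 \<Pi> (I, I) \<phi> \<theta>) = snd (eval D1 \<Pi> (I, I) \<phi> \<theta>)"
    if "(A, \<phi>, \<theta>) \<in> inst D P" for A \<phi> \<theta>
    using eval_exact[OF D D1 inst_sorted[OF P that]] .
  then show ?thesis
    unfolding Phi_alt fst_conv snd_conv approximates_structure_cong[OF D1] by blast
qed

lemma approximator_Phi:
  assumes "is_structure \<Sigma> D" "is_program \<Sigma> \<Pi> P" "approximates_structure \<Sigma> D1 D"
  shows "approximator (base D \<Pi>) (Phi D1 \<Pi> P)"
proof -
  have "le_structure \<Sigma> D1 D1"
    by (simp add: le_structure_def)
  note Phi_mono[OF assms(1,2,3,3) this]
  then show ?thesis
    by unfold_locales auto
qed

theorem theorem5:
  fixes \<Sigma> :: "('s, 'f, 'p, 'a) agg_signature"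
    and \<Pi> :: "'p \<rightharpoonup> 's list"
    and D :: "('s, 'f, 'p, 'a, 'd) agg_structure"
    and D1 D2 :: "('s, 'f, 'p, 'a, 'd) agg_structure3"
    and P :: "('v, 's, 'f, 'p, 'a) rule set"
  assumes "wf_signature \<Sigma>"
    and "is_structure \<Sigma> D"
    and "defined_preds \<Sigma> \<Pi>"
    and "is_program \<Sigma> \<Pi> P"
    and "approximates_structure \<Sigma> D1 D"
    and "approximates_structure \<Sigma> D2 D"
    and "le_structure \<Sigma> D1 D2"
  shows "kripke_kleene_model D1 \<Pi> P \<le>\<^sub>p kripke_kleene_model D2 \<Pi> P
       \<and> well_founded_model D1 \<Pi> P \<le>\<^sub>p well_founded_model D2 \<Pi> P
       \<and> (\<forall>I. stable_model D1 \<Pi> P I \<longrightarrow> stable_model D2 \<Pi> P I)"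
proof -
  have "Phi D1 \<Pi> P x \<le>\<^sub>p Phi D2 \<Pi> P x" if "x \<in> consistent (base D \<Pi>)" for x
    using Phi_mono[OF assms(2,4-7) that that le_p_refl] by (rule conjunct2)
  then have le: "approximator_le (base D \<Pi>) (Phi D1 \<Pi> P) (Phi D2 \<Pi> P)"
    by (intro approximator_le.intro approximator_le_axioms.intro
        approximator_Phi[OF assms(2,4,5)] approximator_Phi[OF assms(2,4,6)])
  note stable = approximator_le.exact_stable_fixpoint_mono[OF le Phi_exact[OF assms(2,4,5)]]
  show ?thesis
    \<comment> \<open>Both structures have the base of \<open>D\<close>, so the two operators act on
      the same set of ground atoms.\<close>
    unfolding kripke_kleene_model_def well_founded_model_def stable_model_def
      approximates_structure_cong(6)[OF assms(5)] approximates_structure_cong(6)[OF assms(6)]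
    by (intro conjI allI impI approximator_le.kk_fixpoint_mono[OF le]
        approximator_le.wf_fixpoint_mono[OF le] stable)
qed

end
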